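(* Let $m\in\mathbb{N}$ and let $\lambda\in\mathbb{R}$ satisfy $\frac{m-1}{m}<\lambda\le\frac{m}{m+1}$. Let $A:\mathbb{R}^2\to\mathbb{R}^2$ be given by $A(x,y)=(\lfloor\lambda y\rfloor,\lfloor\lambda x\rfloor)$. Then the following hold for $z=(x_0,y_0)\in\mathbb{R}^2$. (1) If $x_0\ge 0$ and $y_0\ge 0$, then $\lim_{n\to\infty}A^n(z)=(0,0)$. (2) For every $k\in\{-1,-2,\dots,-m\}$: if $z\in\{(x_0,y_0): \frac{k}{\lambda}\le x_0<\frac{k+1}{\lambda},\ y_0\ge 0\}\cup\{(x_0,y_0): \frac{k}{\lambda}\le y_0<\frac{k+1}{\lambda},\ x_0\ge 0\}$, then $\omega(z)=\{(k,0),(0,k)\}$. (3) If $z\in\{(x_0,y_0): x_0<\frac{-m}{\lambda},\ y_0\ge 0\}\cup\{(x_0,y_0): y_0<\frac{-m}{\lambda},\ x_0\ge 0\}$, then $\omega(z)=\{(-m,0),(0,-m)\}$. (4) If $x_0<\frac{-m+1}{\lambda}$ and $y_0<\frac{-m+1}{\lambda}$, then $\lim_{n\to\infty}A^n(z)=(-m,-m)$. (5) For every $k\in\{-1,-2,\dots,-m\}$ and $p\in\{-1,-2,\dots,-m\}$: if $\frac{k}{\lambda}\le x_0<\frac{k+1}{\lambda}$ and $\frac{p}{\lambda}\le y_0<\frac{p+1}{\lambda}$, then $\omega(z)=\{(k,p),(p,k)\}$. (6) For every $k\in\{-1,-2,\dots,-m\}$: if $z\in\{(x_0,y_0): x_0<\frac{-m+1}{\lambda},\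 \frac{k}{\lambda}\le y_0<\frac{k+1}{\lambda}\}\cup\{(x_0,y_0): \frac{k}{\lambda}\le x_0<\frac{k+1}{\lambda},\ y_0<\frac{-m+1}{\lambda}\}$, then $\omega(z)=\{(k,-m),(-m,k)\}$.
   Context: $\mathbb{N}=\{1,2,3,\dots\}$. $\lfloor t\rfloor$ denotes the integer part (floor) of the real number $t$, i.e. the greatest integer $\le t$. $A^n$ denotes the $n$-fold composition of $A$ with itself. The $\omega$-limit set $\omega(z)$ is the set of limit points of the forward orbit $\{A^n(z)\}_{n\in\mathbb{N}}$: $w\in\omega(z)$ if and only if there is a strictly increasing sequence of natural numbers $\{n_k\}_{k\in\mathbb{N}}$ with $A^{n_k}(z)\to w$ as $k\to\infty$. *)

theory Defs
  imports Complex_Main "HOL-Analysis.Product_Vector"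
begin

definition floor_map :: "real \<Rightarrow> real \<times> real \<Rightarrow> real \<times> real" where
  "floor_map lam = (\<lambda>(x, y). (real_of_int \<lfloor>lam * y\<rfloor>, real_of_int \<lfloor>lam * x\<rfloor>))"

(* The forward orbit consists of the iterates with index at least 1. *)
definition omega_limit :: "('a::topological_space \<Rightarrow> 'a) \<Rightarrow> 'a \<Rightarrow> 'a set" where
  "omega_limit f z =
     {w. \<exists>r::nat \<Rightarrow> nat. strict_mono r \<and> (\<forall>k. r k \<ge> 1) \<and> (\<lambda>k. (f ^^ r k) z) \<longlonglongrightarrow> w}"

end

(* The second iterate of A acts on each coordinate separately by the square of g(t) = floor(lam t),
   so everything reduces to the dynamics of g on the line: -m, ..., -1, 0 are fixed by g, every
   nonnegative integer decreases to 0 and every integer below -m increases to -m, both in finitely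
   many steps.  Hence an orbit of A is eventually the 2-cycle {(a, b), (b, a)}, where a and b are the
   eventual values of the orbits of x0 and y0 under g. *)
theory Submission
  imports Defs
begin

definition floor_mult :: "real \<Rightarrow> real \<Rightarrow> real" where
  "floor_mult lam t = of_int \<lfloor>lam * t\<rfloor>"

text \<open>The map is the coordinate swap composed with \<open>floor_mult lam\<close> on both
  coordinates, and the two commute. So only the parity of \<open>n\<close> decides whether the
  coordinates end up exchanged.\<close>

lemma floor_map_funpow:
  "(floor_map lam ^^ n) (x, y) =
     (if even n then ((floor_mult lam ^^ n) x, (floor_mult lam ^^ n) y)
      else ((floor_mult lam ^^ n) y, (floor_mult lam ^^ n) x))"
proof -
  have "floor_map lam (u, v) = (floor_mult lam v, floor_mult lam u)" for u v
    by (simp add: floor_map_def floor_mult_def)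
  then show ?thesis
    by (induction n) auto
qed

text \<open>A subsequence of the orbit is eventually confined to the finite set
  \<open>{p, q}\<close>, which is closed in a T1 space, so its limit lies there. Conversely, even
  and odd indices give eventually constant subsequences.\<close>

lemma omega_limit_eventually_two_cycle:
  fixes f :: "'a::t1_space \<Rightarrow> 'a"
  assumes "\<forall>\<^sub>F n in sequentially. (f ^^ n) z = (if even n then p else q)"
  shows "omega_limit f z = {p, q}"
proof
  obtain N where N: "\<And>n. n \<ge> N \<Longrightarrow> (f ^^ n) z = (if even n then p else q)"
    using assms by (auto simp: eventually_sequentially)
  show "omega_limit f z \<subseteq> {p, q}"
  proof
    fix w assume "w \<in> omega_limit f z"
    then obtain r :: "nat \<Rightarrow> nat" where r: "strict_mono r" "(\<lambda>k. (f ^^ r k) z) \<longlonglongrightarrow> w"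
      by (auto simp: omega_limit_def)
    have "(f ^^ r k) z \<in> {p, q}" if "k \<ge> N" for k
      using N[of "r k"] seq_suble[OF r(1), of k] that by auto
    then have "\<forall>\<^sub>F k in sequentially. (f ^^ r k) z \<in> {p, q}"
      by (rule eventually_sequentiallyI)
    with r(2) show "w \<in> {p, q}"
      by (intro Lim_in_closed_set) auto
  qed
  \<comment> \<open>The offsets 2 and 1 fix the parity and keep every index at least 1, as
    \<open>omega_limit\<close> demands, even when \<open>N = 0\<close>.\<close>
  have "(\<lambda>k. (f ^^ (2 * (k + N) + 2)) z) = (\<lambda>k. p)" "(\<lambda>k. (f ^^ (2 * (k + N) + 1)) z) = (\<lambda>k. q)"
    by (auto simp: N simp del: funpow.simps)
  then have "(\<lambda>k. (f ^^ (2 * (k + N) + 2)) z) \<longlonglongrightarrow> p" "(\<lambda>k. (f ^^ (2 * (k + N) + 1)) z) \<longlonglongrightarrow> q"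
    by (simp_all only: tendsto_const)
  moreover have "strict_mono (\<lambda>k. 2 * (k + N) + 2)" "strict_mono (\<lambda>k. 2 * (k + N) + 1)"
    by (auto simp: strict_mono_def)
  ultimately show "{p, q} \<subseteq> omega_limit f z"
    unfolding omega_limit_def by fastforce
qed

text \<open>Eventual equality rather than convergence: after one step the orbit consists of
  integers, and the two-cycle argument needs exact values.\<close>

definition settles :: "real \<Rightarrow> real \<Rightarrow> real \<Rightarrow> bool" where
  "settles lam a t \<longleftrightarrow> (\<forall>\<^sub>F n in sequentially. (floor_mult lam ^^ n) t = a)"

text \<open>The orbit of the image is the orbit of \<open>t\<close> shifted by one index. This lets
  the inductions below pass to a smaller case after one step.\<close>

lemma settles_step: "settles lam a (floor_mult lam t) \<Longrightarrow> settles lam a t"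
  unfolding settles_def
  by (subst eventually_sequentially_Suc[symmetric]) (simp add: funpow_Suc_right del: funpow.simps)

lemma settles_fixpoint:
  assumes "floor_mult lam a = a"
  shows "settles lam a a"
proof -
  have "(floor_mult lam ^^ n) a = a" for n
    using assms by (induction n) auto
  then show ?thesis
    by (simp add: settles_def)
qed

lemma floor_map_settles:
  assumes "settles lam a x" "settles lam b y"
  shows "\<forall>\<^sub>F n in sequentially. (floor_map lam ^^ n) (x, y) = (if even n then (a, b) else (b, a))"
  using assms unfolding settles_def by eventually_elim (simp add: floor_map_funpow)

lemma omega_limit_floor_map:
  assumes "settles lam a x" "settles lam b y"
  shows "omega_limit (floor_map lam) (x, y) = {(a, b), (b, a)}"
  by (rule omega_limit_eventually_two_cycle) (rule floor_map_settles[OF assms])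

lemma floor_map_tendsto_diagonal:
  assumes "settles lam a x" "settles lam a y"
  shows "(\<lambda>n. (floor_map lam ^^ n) (x, y)) \<longlonglongrightarrow> (a, a)"
  using floor_map_settles[OF assms] by (intro tendsto_eventually) simp

lemma floor_mult_eqI: "of_int k \<le> lam * t \<Longrightarrow> lam * t < of_int k + 1 \<Longrightarrow> floor_mult lam t = of_int k"
  by (simp add: floor_mult_def floor_eq_iff)

lemma settles_nonneg:
  assumes lam: "0 \<le> lam" "lam < 1" and t: "t \<ge> 0"
  shows "settles lam 0 t"
proof -
  have *: "settles lam 0 (real n)" for n
  proof (induction n rule: less_induct)
    case (less n)
    show ?case
    proof (cases "n = 0")
      case True
      then show ?thesis by (simp add: settles_fixpoint floor_mult_def)
    next
      case False
      \<comment> \<open>Since \<open>lam < 1\<close>, multiplying a positive \<open>n\<close> by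
        \<open>lam\<close> strictly decreases it, and the floor only lowers it further; the result
        is again a natural number.\<close>
      define n' where "n' = nat \<lfloor>lam * real n\<rfloor>"
      have n': "real n' = floor_mult lam (real n)"
        using lam by (simp add: n'_def floor_mult_def)
      also have "\<dots> \<le> lam * real n"
        by (simp add: floor_mult_def)
      also have "\<dots> < real n"
        using lam False by simp
      finally have "n' < n" by simp
      from less[OF this] have "settles lam 0 (floor_mult lam (real n))"
        by (simp add: n')
      then show ?thesis
        by (rule settles_step)
    qed
  qed
  \<comment> \<open>One step carries any nonnegative real to a natural number.\<close>
  have "floor_mult lam t = real (nat \<lfloor>lam * t\<rfloor>)"
    using lam t by (simp add: floor_mult_def)
  with * show ?thesis
    by (metis settles_step)
qed

context
  fixes m :: nat and lam :: real
  assumes m: "m \<ge> 1"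
    and lam_gt: "(real m - 1) / real m < lam" and lam_le: "lam \<le> real m / (real m + 1)"
begin

lemma lam_pos: "lam > 0"
  using m lam_gt by (intro le_less_trans[OF _ lam_gt]) simp

lemma lam_less_1: "lam < 1"
  using lam_le by (rule le_less_trans) simp

text \<open>The lower bound \<open>k \<le> lam * k\<close> holds because \<open>k < 0\<close> and
  \<open>lam < 1\<close>. The upper bound amounts to \<open>(1 - lam) * (-k) < 1\<close>, which is
  hardest at \<open>k = -m\<close>, where it is exactly the hypothesis
  \<open>(m - 1) / m < lam\<close>.\<close>

lemma floor_mult_fixpoint:
  assumes "k \<in> {- int m .. -1}"
  shows "floor_mult lam (of_int k) = of_int k"
proof (rule floor_mult_eqI)
  have k: "- real m \<le> real_of_int k" "real_of_int k \<le> -1"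
    using assms by (auto simp: of_int_le_iff[where 'a = real, symmetric] simp del: of_int_le_iff)
  show "of_int k \<le> lam * real_of_int k"
    using lam_less_1 k mult_right_mono_neg[of lam 1 "real_of_int k"] by simp
  have "real m - 1 < lam * real m"
    using m lam_gt by (simp add: field_simps)
  moreover have "(1 - lam) * (- of_int k) \<le> (1 - lam) * real m"
    using lam_less_1 k by (intro mult_left_mono) auto
  ultimately show "lam * real_of_int k < of_int k + 1"
    by (simp add: algebra_simps)
qed

text \<open>The cell is the preimage of \<open>k\<close> under \<open>floor_mult lam\<close>, so the
  fixed point is reached in one step.\<close>

lemma settles_cell:
  assumes "k \<in> {- int m .. -1}" "of_int k / lam \<le> t" "t < (of_int k + 1) / lam"
  shows "settles lam (of_int k) t"
proof -
  have "floor_mult lam t = of_int k"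
    using assms lam_pos by (intro floor_mult_eqI) (simp_all add: field_simps)
  then show ?thesis
    using settles_fixpoint[OF floor_mult_fixpoint[OF assms(1)]]
    by (metis settles_step)
qed

lemma settles_minus_nat: "j \<ge> m \<Longrightarrow> settles lam (- real m) (- real j)"
proof (induction j rule: less_induct)
  case (less j)
  have fix_m: "floor_mult lam (- real m) = - real m"
    using floor_mult_fixpoint[of "- int m"] m by simp
  show ?case
  proof (cases "j = m")
    case True
    then show ?thesis using fix_m by (simp add: settles_fixpoint)
  next
    case False
    with less.prems have j: "real j \<ge> real m + 1" by simp
    \<comment> \<open>This restates \<open>lam \<le> m / (m + 1)\<close>. Hence for
      \<open>j \<ge> m + 1\<close> multiplication by \<open>lam\<close> raises \<open>-j\<close> by
      at least 1, and the floor is at least \<open>-j + 1\<close>.\<close>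
    have "(real m + 1) * (1 - lam) \<ge> 1"
      using lam_le by (simp add: field_simps)
    moreover have "(real m + 1) * (1 - lam) \<le> real j * (1 - lam)"
      using j lam_less_1 by (intro mult_right_mono) auto
    ultimately have "- real j + 1 \<le> lam * (- real j)"
      by (simp add: algebra_simps)
    then have up: "- int j + 1 \<le> \<lfloor>lam * (- real j)\<rfloor>"
      by (simp add: le_floor_iff)
    \<comment> \<open>Monotonicity and comparison with the fixed point \<open>-m\<close> show that
      the orbit cannot jump over it.\<close>
    have "lam * (- real j) \<le> lam * (- real m)"
      using j lam_pos by (intro mult_left_mono) auto
    then have "\<lfloor>lam * (- real j)\<rfloor> \<le> \<lfloor>lam * (- real m)\<rfloor>"
      by (rule floor_mono)
    also have "\<dots> = - int m"
      using fix_m by (simp add: floor_mult_def)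
    finally have low: "\<lfloor>lam * (- real j)\<rfloor> \<le> - int m" .
    define j' where "j' = nat (- \<lfloor>lam * (- real j)\<rfloor>)"
    have j'_eq: "\<lfloor>lam * (- real j)\<rfloor> = - int j'"
      using low m unfolding j'_def by linarith
    have "j' < j" "j' \<ge> m"
      using up low unfolding j'_eq by linarith+
    moreover have "floor_mult lam (- real j) = - real j'"
      unfolding floor_mult_def j'_eq by simp
    ultimately show ?thesis
      using less.IH by (metis settles_step)
  qed
qed

text \<open>Below this threshold \<open>lam * t < -m + 1\<close>, so one step lands on an integer
  that is at most \<open>-m\<close>.\<close>

lemma settles_below:
  assumes "t < (- real m + 1) / lam"
  shows "settles lam (- real m) t"
proof -
  have "lam * t < of_int (- int m + 1)"
    using assms lam_pos by (simp add: field_simps)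
  then have low: "\<lfloor>lam * t\<rfloor> \<le> - int m"
    by (simp only: flip: floor_less_iff)
  define j where "j = nat (- \<lfloor>lam * t\<rfloor>)"
  have j_eq: "\<lfloor>lam * t\<rfloor> = - int j"
    using low m unfolding j_def by linarith
  have "j \<ge> m" "floor_mult lam t = - real j"
    using low by (simp_all add: floor_mult_def j_eq)
  then show ?thesis
    using settles_minus_nat by (metis settles_step)
qed

lemma settles_far_below:
  assumes "t < (- real m) / lam"
  shows "settles lam (- real m) t"
proof (rule settles_below)
  have "(- real m) / lam \<le> (- real m + 1) / lam"
    using lam_pos by (intro divide_right_mono) auto
  with assms show "t < (- real m + 1) / lam" by simp
qed

end

theorem theorem2:
  fixes m :: nat and lam :: real and A :: "real \<times> real \<Rightarrow> real \<times> real" and x0 y0 :: real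
  assumes "m \<ge> 1"
    and "(real m - 1) / real m < lam" and "lam \<le> real m / (real m + 1)"
    and "A = floor_map lam"
  shows
    "(x0 \<ge> 0 \<and> y0 \<ge> 0 \<longrightarrow> (\<lambda>n. (A ^^ n) (x0, y0)) \<longlonglongrightarrow> (0, 0))
   \<and> (\<forall>k::int. k \<in> {- int m .. -1} \<longrightarrow>
        (x0, y0) \<in> {(x, y). of_int k / lam \<le> x \<and> x < (of_int k + 1) / lam \<and> y \<ge> 0}
                 \<union> {(x, y). of_int k / lam \<le> y \<and> y < (of_int k + 1) / lam \<and> x \<ge> 0} \<longrightarrow>
        omega_limit A (x0, y0) = {(of_int k, 0), (0, of_int k)})
   \<and> ((x0, y0) \<in> {(x, y). x < (- real m) / lam \<and> y \<ge> 0}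
                \<union> {(x, y). y < (- real m) / lam \<and> x \<ge> 0} \<longrightarrow>
        omega_limit A (x0, y0) = {(- real m, 0), (0, - real m)})
   \<and> (x0 < (- real m + 1) / lam \<and> y0 < (- real m + 1) / lam \<longrightarrow>
        (\<lambda>n. (A ^^ n) (x0, y0)) \<longlonglongrightarrow> (- real m, - real m))
   \<and> (\<forall>k::int. \<forall>p::int. k \<in> {- int m .. -1} \<longrightarrow> p \<in> {- int m .. -1} \<longrightarrow>
        of_int k / lam \<le> x0 \<and> x0 < (of_int k + 1) / lam \<and>
        of_int p / lam \<le> y0 \<and> y0 < (of_int p + 1) / lam \<longrightarrow>
        omega_limit A (x0, y0) = {(of_int k, of_int p), (of_int p, of_int k)})
   \<and> (\<forall>k::int. k \<in> {- int m .. -1} \<longrightarrow>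
        (x0, y0) \<in> {(x, y). x < (- real m + 1) / lam \<and> of_int k / lam \<le> y \<and> y < (of_int k + 1) / lam}
                 \<union> {(x, y). of_int k / lam \<le> x \<and> x < (of_int k + 1) / lam \<and> y < (- real m + 1) / lam} \<longrightarrow>
        omega_limit A (x0, y0) = {(of_int k, - real m), (- real m, of_int k)})"
proof -
  note params = assms(1-3)
  note A = assms(4)
  have nonneg: "settles lam 0 t" if "t \<ge> 0" for t
    using that lam_pos[OF params] lam_less_1[OF params] by (intro settles_nonneg) auto
  note cell = settles_cell[OF params]
  note below = settles_below[OF params]
  note far_below = settles_far_below[OF params]
  note omega = omega_limit_floor_map
  show ?thesis
    unfolding A
  proof (intro conjI allI impI, goal_cases)
    case 1
    then show ?case
      by (intro floor_map_tendsto_diagonal nonneg) auto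
  next
    case (2 k)
    \<comment> \<open>The two instances treat the two halves of the union; the second yields the
      same pair of points in the opposite order.\<close>
    then show ?case
      using omega[OF cell nonneg, of k x0 y0] omega[OF nonneg cell, of x0 k y0] by auto
  next
    case 3
    then show ?case
      using omega[OF far_below nonneg, of x0 y0] omega[OF nonneg far_below, of x0 y0] by auto
  next
    case 4
    then show ?case
      by (intro floor_map_tendsto_diagonal below) auto
  next
    case (5 k p)
    then show ?case
      by (intro omega cell) auto
  next
    case (6 k)
    then show ?case
      using omega[OF below cell, of x0 k y0] omega[OF cell below, of k x0 y0] by auto
  qed
qed

end
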